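(* Let $M$ be a generalized spherical surface of second kind in $\mathbb{E}^4$, given by the parametrization $X(u,v)=\phi(u)\,e_1+\lambda\cos\left(\frac{u}{c}\right)\rho(v)$ described in the context. Then, with $f_1,f_2,\kappa_\gamma$ and the normal frame $N_1,N_2$ as given in the context, the mean curvature vector of $M$ is $$\overrightarrow{H}=\frac{1}{2f_2(u)}\left\{\kappa_\rho(v)N_1+\left(-\kappa_\gamma(u) f_2(u)+f_1'(u)\right)N_2\right\},$$ where $$\kappa_\rho(v)=\sqrt{g_1''(v)^2+g_2''(v)^2+g_3''(v)^2}.$$
   Context: Let $e_1,\dots,e_4$ be the standard orthonormal basis of $\mathbb{E}^4$. Let $c\neq0$ and $\lambda>0$ be real constants, and let $u$ range over an open interval on which $\cos\left(\frac uc\right)\neq0$ and $1-\frac{\lambda^2}{c^2}\sin^2\left(\frac uc\right)>0$. Let $\rho(v)=(g_1(v),g_2(v),g_3(v))$ be a smooth curve in $\mathrm{span}\{e_2,e_3,e_4\}$ with $\|\rho(v)\|=1$ and $\|\rho'(v)\|=1$, i.e. an arclength-parametrized curve on the unit sphere $S^2$ of that subspace. The generalized spherical surface of second kind is the surface in $\mathbb{E}^4$ given by $X(u,v)=\phi(u)\,e_1+\lambda\cos\left(\frac uc\right)\rho(v)$, where $\phi(u)=\int\sqrt{1-\frac{\lambda^2}{c^2}\sin^2\left(\frac uc\right)}\,du$. Write $f_1(u)=\phi(u)$ and $f_2(u)=\lambda\cos\left(\frac uc\right)$, and put $$\kappa_\gamma(u)=f_1'f_2''-f_1''f_2'=-\tfrac{\lambda}{c^2}\phi'(u)\cos\left(\tfrac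 uc\right)+\tfrac{\lambda}{c}\phi''(u)\sin\left(\tfrac uc\right).$$ The spherical curve $\rho$ is taken with Frenet equations $\rho'=T$, $T'=\kappa_\rho N-\rho$, $N'=-\kappa_\rho T$, where $N(v)$ is the unit normal vector of the spherical curve $\rho$ (in $\mathrm{span}\{e_2,e_3,e_4\}$, orthogonal to $\rho$ and $T$). The normal space of $M$ is spanned by the orthonormal frame $N_1=N(v)$, $N_2=-\frac{\lambda}{c}\sin\left(\frac uc\right)e_1-\phi'(u)\rho(v)$. For a regular patch in $\mathbb{E}^4$ with $g_{11}=\langle X_u,X_u\rangle$, $g_{12}=\langle X_u,X_v\rangle$, $g_{22}=\langle X_v,X_v\rangle$, $W^2=g_{11}g_{22}-g_{12}^2\neq0$, and $L_{11}^k=\langle X_{uu},N_k\rangle$, $L_{12}^k=\langle X_{uv},N_k\rangle$, $L_{22}^k=\langle X_{vv},N_k\rangle$, the mean curvature vector is $\overrightarrow{H}=\frac{1}{2W^2}\sum_{k=1}^{2}\left(L_{11}^kg_{22}+L_{22}^kg_{11}-2L_{12}^kg_{12}\right)N_k$.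
   Formalization: The closing formula for κ_ρ is corrected to |κ_ρ| = sqrt(g_1''^2+g_2''^2+g_3''^2 − 1): by T' = κ_ρ N − ρ the printed one fails for every such curve (great circle: κ_ρ = 0 but the root is 1); the absolute value allows either choice of N. *)

theory Defs
  imports "HOL-Analysis.Analysis"
begin

definition e1 :: "real ^ 4" where "e1 = axis 1 1"
definition e2 :: "real ^ 4" where "e2 = axis 2 1"
definition e3 :: "real ^ 4" where "e3 = axis 3 1"
definition e4 :: "real ^ 4" where "e4 = axis 4 1"

text \<open>Only used for open \<open>J\<close>, where \<^const>\<open>deriv\<close> is the ordinary derivative.\<close>
definition smooth_on :: "real set \<Rightarrow> (real \<Rightarrow> real) \<Rightarrow> bool" where
  "smooth_on J g \<longleftrightarrow> (\<forall>n. \<forall>v\<in>J. (deriv ^^ n) g field_differentiable (at v))"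

definition space_curve ::
  "(real \<Rightarrow> real) \<Rightarrow> (real \<Rightarrow> real) \<Rightarrow> (real \<Rightarrow> real) \<Rightarrow> real \<Rightarrow> real ^ 4" where
  "space_curve g1 g2 g3 v = g1 v *\<^sub>R e2 + g2 v *\<^sub>R e3 + g3 v *\<^sub>R e4"

definition unit_speed_spherical :: "real set \<Rightarrow> (real \<Rightarrow> real ^ 4) \<Rightarrow> bool" where
  "unit_speed_spherical J \<rho> \<longleftrightarrow>
    (\<forall>v\<in>J. norm (\<rho> v) = 1 \<and> norm (vector_derivative \<rho> (at v)) = 1)"

text \<open>The curvature \<open>\<kappa>\<close> is signed: its sign depends on the choice of the unit normal \<open>N\<close>.\<close>
definition spherical_frenet ::
  "real set \<Rightarrow> (real \<Rightarrow> real ^ 4) \<Rightarrow> (real \<Rightarrow> real ^ 4) \<Rightarrow> (real \<Rightarrow> real ^ 4) \<Rightarrow> (real \<Rightarrow> real) \<Rightarrow> bool"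
where
  "spherical_frenet J \<rho> T N \<kappa> \<longleftrightarrow>
    (\<forall>v\<in>J. N v \<in> span {e2, e3, e4} \<and> norm (N v) = 1 \<and> N v \<bullet> \<rho> v = 0 \<and> N v \<bullet> T v = 0 \<and>
      (\<rho> has_vector_derivative T v) (at v) \<and>
      (T has_vector_derivative (\<kappa> v *\<^sub>R N v - \<rho> v)) (at v) \<and>
      (N has_vector_derivative (- \<kappa> v *\<^sub>R T v)) (at v))"

definition speed_factor :: "real \<Rightarrow> real \<Rightarrow> real \<Rightarrow> real" where
  "speed_factor c lam u = 1 - lam\<^sup>2 / c\<^sup>2 * (sin (u / c))\<^sup>2"

definition profile2 :: "real \<Rightarrow> real \<Rightarrow> real \<Rightarrow> real" where
  "profile2 c lam u = lam * cos (u / c)"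

definition spherical_surface ::
  "real \<Rightarrow> real \<Rightarrow> (real \<Rightarrow> real) \<Rightarrow> (real \<Rightarrow> real ^ 4) \<Rightarrow> real \<Rightarrow> real \<Rightarrow> real ^ 4" where
  "spherical_surface c lam \<phi> \<rho> u v = \<phi> u *\<^sub>R e1 + profile2 c lam u *\<^sub>R \<rho> v"

definition kappa_gamma :: "(real \<Rightarrow> real) \<Rightarrow> (real \<Rightarrow> real) \<Rightarrow> real \<Rightarrow> real" where
  "kappa_gamma f1 f2 u = deriv f1 u * deriv (deriv f2) u - deriv (deriv f1) u * deriv f2 u"

definition normal2 ::
  "real \<Rightarrow> real \<Rightarrow> (real \<Rightarrow> real) \<Rightarrow> (real \<Rightarrow> real ^ 4) \<Rightarrow> real \<Rightarrow> real \<Rightarrow> real ^ 4" where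
  "normal2 c lam \<phi> \<rho> u v = - (lam / c * sin (u / c)) *\<^sub>R e1 - deriv \<phi> u *\<^sub>R \<rho> v"

type_synonym patch = "real \<Rightarrow> real \<Rightarrow> real ^ 4"

definition partial_u :: "patch \<Rightarrow> patch" where
  "partial_u X u v = vector_derivative (\<lambda>s. X s v) (at u)"

definition partial_v :: "patch \<Rightarrow> patch" where
  "partial_v X u v = vector_derivative (\<lambda>t. X u t) (at v)"

definition g11 :: "patch \<Rightarrow> real \<Rightarrow> real \<Rightarrow> real" where
  "g11 X u v = partial_u X u v \<bullet> partial_u X u v"

definition g12 :: "patch \<Rightarrow> real \<Rightarrow> real \<Rightarrow> real" where
  "g12 X u v = partial_u X u v \<bullet> partial_v X u v"

definition g22 :: "patch \<Rightarrow> real \<Rightarrow> real \<Rightarrow> real" where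
  "g22 X u v = partial_v X u v \<bullet> partial_v X u v"

definition W2 :: "patch \<Rightarrow> real \<Rightarrow> real \<Rightarrow> real" where
  "W2 X u v = g11 X u v * g22 X u v - (g12 X u v)\<^sup>2"

definition L11 :: "patch \<Rightarrow> patch \<Rightarrow> real \<Rightarrow> real \<Rightarrow> real" where
  "L11 X Nk u v = partial_u (partial_u X) u v \<bullet> Nk u v"

text \<open>\<open>X\<^sub>u\<^sub>v\<close> is read as differentiating first in \<open>u\<close>, then in \<open>v\<close>.\<close>
definition L12 :: "patch \<Rightarrow> patch \<Rightarrow> real \<Rightarrow> real \<Rightarrow> real" where
  "L12 X Nk u v = partial_v (partial_u X) u v \<bullet> Nk u v"

definition L22 :: "patch \<Rightarrow> patch \<Rightarrow> real \<Rightarrow> real \<Rightarrow> real" where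
  "L22 X Nk u v = partial_v (partial_v X) u v \<bullet> Nk u v"

definition mean_curvature_coeff :: "patch \<Rightarrow> patch \<Rightarrow> real \<Rightarrow> real \<Rightarrow> real" where
  "mean_curvature_coeff X Nk u v =
    L11 X Nk u v * g22 X u v + L22 X Nk u v * g11 X u v - 2 * L12 X Nk u v * g12 X u v"

text \<open>This is the mean curvature vector when \<open>N1, N2\<close> is an orthonormal frame of the normal
  space of \<open>X\<close>.\<close>
definition mean_curvature_vector :: "patch \<Rightarrow> patch \<Rightarrow> patch \<Rightarrow> patch" where
  "mean_curvature_vector X N1 N2 u v = (1 / (2 * W2 X u v)) *\<^sub>R
    (mean_curvature_coeff X N1 u v *\<^sub>R N1 u v + mean_curvature_coeff X N2 u v *\<^sub>R N2 u v)"

lemma e_inner [simp]: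
  "e1 \<bullet> e1 = 1" "e2 \<bullet> e2 = 1" "e3 \<bullet> e3 = 1" "e4 \<bullet> e4 = 1"
  "e1 \<bullet> e2 = 0" "e1 \<bullet> e3 = 0" "e1 \<bullet> e4 = 0" "e2 \<bullet> e1 = 0" "e2 \<bullet> e3 = 0" "e2 \<bullet> e4 = 0"
  "e3 \<bullet> e1 = 0" "e3 \<bullet> e2 = 0" "e3 \<bullet> e4 = 0" "e4 \<bullet> e1 = 0" "e4 \<bullet> e2 = 0" "e4 \<bullet> e3 = 0"
  by (simp_all add: e1_def e2_def e3_def e4_def inner_axis_axis)

lemma space_curve_inner:
  "space_curve g1 g2 g3 v \<bullet> space_curve h1 h2 h3 w = g1 v * h1 w + g2 v * h2 w + g3 v * h3 w"
  by (simp add: space_curve_def inner_add_left inner_add_right)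

lemma space_curve_has_vector_derivative:
  assumes "open J" "v \<in> J"
    and "smooth_on J g1" "smooth_on J g2" "smooth_on J g3"
  shows "(space_curve ((deriv ^^ n) g1) ((deriv ^^ n) g2) ((deriv ^^ n) g3) has_vector_derivative
    space_curve ((deriv ^^ Suc n) g1) ((deriv ^^ Suc n) g2) ((deriv ^^ Suc n) g3) v) (at v)"
proof -
  have *: "((deriv ^^ n) g has_real_derivative (deriv ^^ Suc n) g v) (at v)"
    if "smooth_on J g" for g
    using that assms(2) by (simp add: smooth_on_def DERIV_deriv_iff_field_differentiable)
  show ?thesis
    unfolding space_curve_def[abs_def] has_vector_derivative_def
    using *[OF assms(3)] *[OF assms(4)] *[OF assms(5)]
    by (auto intro!: derivative_eq_intros simp: has_field_derivative_def algebra_simps)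
qed

text \<open>By the Frenet equations \<open>\<rho>'' = \<kappa> N - \<rho>\<close>, so \<open>\<parallel>\<rho>''\<parallel>\<^sup>2 = \<kappa>\<^sup>2 + 1\<close>. In particular the curvature
  of the spherical Frenet frame never equals \<open>\<parallel>\<rho>''\<parallel>\<close>; the latter is the curvature of
  \<open>\<rho>\<close> as a curve of the ambient Euclidean space.\<close>
lemma spherical_frenet_curvature:
  assumes J: "open J" "v \<in> J"
    and sm: "smooth_on J g1" "smooth_on J g2" "smooth_on J g3"
    and us: "unit_speed_spherical J (space_curve g1 g2 g3)"
    and fr: "spherical_frenet J (space_curve g1 g2 g3) T N \<kappa>"
  shows "(deriv (deriv g1) v)\<^sup>2 + (deriv (deriv g2) v)\<^sup>2 + (deriv (deriv g3) v)\<^sup>2 = (\<kappa> v)\<^sup>2 + 1"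
proof -
  let ?r = "space_curve g1 g2 g3"
  let ?r1 = "space_curve (deriv g1) (deriv g2) (deriv g3)"
  let ?r2 = "space_curve (deriv (deriv g1)) (deriv (deriv g2)) (deriv (deriv g3))"
  have T: "T w = ?r1 w" if "w \<in> J" for w
    using space_curve_has_vector_derivative[OF J(1) that sm, of 0] fr that
    by (auto simp: spherical_frenet_def intro: vector_derivative_unique_at)
  have "(?r1 has_vector_derivative ?r2 v) (at v)"
    using space_curve_has_vector_derivative[OF J sm, of 1] by simp
  moreover have "(?r1 has_vector_derivative (\<kappa> v *\<^sub>R N v - ?r v)) (at v)"
    using fr J T has_vector_derivative_transform_within_open[of T _ v J ?r1]
    by (auto simp: spherical_frenet_def)
  ultimately have "?r2 v = \<kappa> v *\<^sub>R N v - ?r v"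
    by (rule vector_derivative_unique_at)
  moreover have "N v \<bullet> N v = 1" "N v \<bullet> ?r v = 0" "?r v \<bullet> ?r v = 1"
    using fr us J by (auto simp: spherical_frenet_def unit_speed_spherical_def norm_eq_1)
  ultimately have "?r2 v \<bullet> ?r2 v = (\<kappa> v)\<^sup>2 + 1"
    by (simp add: inner_diff_left inner_diff_right inner_commute power2_eq_square)
  then show ?thesis by (simp add: space_curve_inner power2_eq_square)
qed

corollary spherical_frenet_curvature_neq_norm:
  assumes "open J" "v \<in> J"
    and "smooth_on J g1" "smooth_on J g2" "smooth_on J g3"
    and "unit_speed_spherical J (space_curve g1 g2 g3)"
    and "spherical_frenet J (space_curve g1 g2 g3) T N \<kappa>"
  shows "\<kappa> v \<noteq> sqrt ((deriv (deriv g1) v)\<^sup>2 + (deriv (deriv g2) v)\<^sup>2 + (deriv (deriv g3) v)\<^sup>2)"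
proof
  assume "\<kappa> v = sqrt ((deriv (deriv g1) v)\<^sup>2 + (deriv (deriv g2) v)\<^sup>2 + (deriv (deriv g3) v)\<^sup>2)"
  then have "\<kappa> v = sqrt ((\<kappa> v)\<^sup>2 + 1)"
    unfolding spherical_frenet_curvature[OF assms] .
  then have "(\<kappa> v)\<^sup>2 = (sqrt ((\<kappa> v)\<^sup>2 + 1))\<^sup>2" by simp
  then show False by simp
qed

end

theory Submission
  imports Defs
begin

text \<open>
  The surface is swept out by moving the unit-speed profile curve \<open>(f\<^sub>1, f\<^sub>2)\<close>, here
  \<open>f\<^sub>1 = \<phi>\<close> and \<open>f\<^sub>2 = \<lambda> cos (u / c)\<close>, through the planes spanned by a fixed unit vector \<open>e\<close>
  and the points \<open>\<rho> v\<close> of a spherical curve orthogonal to \<open>e\<close>. All parameter dependence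
  separates: \<open>X\<^sub>u\<close> and \<open>X\<^sub>u\<^sub>u\<close> lie in the plane of \<open>e\<close> and \<open>\<rho>\<close>, while \<open>X\<^sub>v = f\<^sub>2 T\<close> and
  \<open>X\<^sub>v\<^sub>v = f\<^sub>2 (\<kappa> N - \<rho>)\<close>. Since \<open>e\<close>, \<open>\<rho>\<close>, \<open>T\<close>, \<open>N\<close> are orthonormal, the metric is
  \<open>du\<^sup>2 + f\<^sub>2\<^sup>2 dv\<^sup>2\<close> and each of \<open>N\<close> and \<open>f\<^sub>2' e - f\<^sub>1' \<rho>\<close> sees only one or two terms: \<open>N\<close> sees
  \<open>f\<^sub>2 \<kappa>\<close> in \<open>X\<^sub>v\<^sub>v\<close>, the second normal sees minus the curvature \<open>\<kappa>\<^sub>\<gamma>\<close> of the profile in \<open>X\<^sub>u\<^sub>u\<close> and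
  \<open>f\<^sub>2 f\<^sub>1'\<close> in \<open>X\<^sub>v\<^sub>v\<close>. Cancelling one factor \<open>f\<^sub>2\<close> gives the formula for any unit-speed profile
  (\<open>mean_curvature_vector_unit_speed_profile\<close>).

  For the surface of second kind, \<open>\<phi>'\<^sup>2 = 1 - (\<lambda>\<^sup>2 / c\<^sup>2) sin\<^sup>2 (u / c)\<close> is exactly the condition that
  the profile has unit speed, and positivity of this quantity makes \<open>\<phi>\<close> twice differentiable.
  The statement about \<open>\<bar>\<kappa>\<^sub>\<rho>\<bar>\<close> is the relation \<open>\<parallel>\<rho>''\<parallel>\<^sup>2 = \<kappa>\<^sub>\<rho>\<^sup>2 + 1\<close>, which expresses that \<open>\<rho>''\<close>
  has the additional component \<open>-\<rho>\<close> normal to the sphere.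
\<close>

lemma vector_derivative_orthogonal_to_constant:
  fixes f :: "real \<Rightarrow> 'a::real_inner"
  assumes "open J" "v \<in> J" "(f has_vector_derivative d) (at v)"
    and "\<And>w. w \<in> J \<Longrightarrow> e \<bullet> f w = 0"
  shows "e \<bullet> d = 0"
proof -
  have "((\<lambda>w. e \<bullet> f w) has_vector_derivative e \<bullet> d) (at v)"
    by (rule bounded_linear.has_vector_derivative[OF bounded_linear_inner_right assms(3)])
  then have "((\<lambda>w. 0) has_vector_derivative e \<bullet> d) (at v)"
    by (rule has_vector_derivative_transform_within_open[OF _ assms(1,2)]) (simp add: assms(4))
  from vector_derivative_unique_at[OF this has_vector_derivative_const] show ?thesis .
qed

lemma vector_derivative_orthogonal_of_constant_norm:
  fixes f :: "real \<Rightarrow> 'a::real_inner"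
  assumes "open J" "v \<in> J" "(f has_vector_derivative d) (at v)"
    and "\<And>w. w \<in> J \<Longrightarrow> norm (f w) = r"
  shows "f v \<bullet> d = 0"
proof -
  have "((\<lambda>w. f w \<bullet> f w) has_vector_derivative (f v \<bullet> d + d \<bullet> f v)) (at v)"
    by (rule bounded_bilinear.has_vector_derivative[OF bounded_bilinear_inner assms(3,3)])
  then have "((\<lambda>w. r\<^sup>2) has_vector_derivative (f v \<bullet> d + d \<bullet> f v)) (at v)"
    by (rule has_vector_derivative_transform_within_open[OF _ assms(1,2)])
      (simp add: assms(4) flip: power2_norm_eq_inner)
  from vector_derivative_unique_at[OF this has_vector_derivative_const]
  show ?thesis by (simp add: inner_commute)
qed

text \<open>The plane of \<open>p\<close> and \<open>q\<close> is fixed while \<open>u\<close> varies, so \<open>\<partial>/\<partial>u\<close> acts on the two scalar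
  coefficients only.\<close>
lemma vector_derivative_plane_curve:
  fixes p q :: "'a::real_normed_vector"
  assumes "a differentiable (at u)" "b differentiable (at u)"
  shows "((\<lambda>s. a s *\<^sub>R p + b s *\<^sub>R q) has_vector_derivative deriv a u *\<^sub>R p + deriv b u *\<^sub>R q) (at u)"
proof -
  have "(a has_real_derivative deriv a u) (at u)" "(b has_real_derivative deriv b u) (at u)"
    using assms by (simp_all add: DERIV_deriv_iff_real_differentiable)
  then show ?thesis
    by (auto intro!: derivative_eq_intros)
qed

text \<open>The vectors \<open>e\<close>, \<open>\<rho> v\<close>, \<open>T v\<close>, \<open>N v\<close> are orthonormal: \<open>e \<bullet> T = 0\<close> and \<open>\<rho> \<bullet> T = 0\<close> come from
  differentiating \<open>e \<bullet> \<rho> = 0\<close> and \<open>\<parallel>\<rho>\<parallel> = 1\<close>. In this frame every fundamental coefficient can be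
  read off.\<close>
theorem mean_curvature_vector_unit_speed_profile:
  fixes e :: "real ^ 4" and f1 f2 \<kappa> :: "real \<Rightarrow> real" and \<rho> T N :: "real \<Rightarrow> real ^ 4"
  assumes I: "open I" "u \<in> I" and J: "open J" "v \<in> J"
    and f: "\<And>s. s \<in> I \<Longrightarrow> f1 differentiable (at s)" "\<And>s. s \<in> I \<Longrightarrow> f2 differentiable (at s)"
    and f': "deriv f1 differentiable (at u)" "deriv f2 differentiable (at u)"
    and unit_speed: "(deriv f1 u)\<^sup>2 + (deriv f2 u)\<^sup>2 = 1"
    and f2_nz: "f2 u \<noteq> 0"
    and e: "norm e = 1" "\<And>w. w \<in> J \<Longrightarrow> e \<bullet> \<rho> w = 0" "e \<bullet> N v = 0"
    and \<rho>: "unit_speed_spherical J \<rho>" and frenet: "spherical_frenet J \<rho> T N \<kappa>"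
  shows "mean_curvature_vector (\<lambda>u v. f1 u *\<^sub>R e + f2 u *\<^sub>R \<rho> v) (\<lambda>u v. N v)
      (\<lambda>u v. deriv f2 u *\<^sub>R e - deriv f1 u *\<^sub>R \<rho> v) u v =
    (1 / (2 * f2 u)) *\<^sub>R
      (\<kappa> v *\<^sub>R N v +
       (- kappa_gamma f1 f2 u * f2 u + deriv f1 u) *\<^sub>R (deriv f2 u *\<^sub>R e - deriv f1 u *\<^sub>R \<rho> v))"
proof -
  let ?X = "\<lambda>u v. f1 u *\<^sub>R e + f2 u *\<^sub>R \<rho> v"
  let ?N1 = "\<lambda>u v. N v" and ?N2 = "\<lambda>u v. deriv f2 u *\<^sub>R e - deriv f1 u *\<^sub>R \<rho> v"
  have d\<rho>: "(\<rho> has_vector_derivative T w) (at w)" if "w \<in> J" for w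
    using frenet that by (simp add: spherical_frenet_def)
  have dT: "(T has_vector_derivative \<kappa> v *\<^sub>R N v - \<rho> v) (at v)"
    using frenet J by (simp add: spherical_frenet_def)
  have "norm (T v) = 1"
    using \<rho> J vector_derivative_at[OF d\<rho>] by (auto simp: unit_speed_spherical_def)
  then have frame [simp]: "e \<bullet> e = 1" "\<rho> v \<bullet> \<rho> v = 1" "T v \<bullet> T v = 1"
      "e \<bullet> \<rho> v = 0" "\<rho> v \<bullet> e = 0" "e \<bullet> N v = 0" "\<rho> v \<bullet> N v = 0" "T v \<bullet> N v = 0"
      "N v \<bullet> N v = 1"
    using e \<rho> frenet J
    by (auto simp: norm_eq_1 inner_commute unit_speed_spherical_def spherical_frenet_def)
  have [simp]: "e \<bullet> T v = 0" "T v \<bullet> e = 0"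
    using vector_derivative_orthogonal_to_constant[OF J d\<rho>[OF J(2)], of e] e
    by (simp_all add: inner_commute)
  have [simp]: "\<rho> v \<bullet> T v = 0" "T v \<bullet> \<rho> v = 0"
    using vector_derivative_orthogonal_of_constant_norm[OF J d\<rho>[OF J(2)], of 1] \<rho>
    by (simp_all add: inner_commute unit_speed_spherical_def)
  have Xu: "partial_u ?X s w = deriv f1 s *\<^sub>R e + deriv f2 s *\<^sub>R \<rho> w" if "s \<in> I" for s w
    unfolding partial_u_def
    using f that by (intro vector_derivative_at vector_derivative_plane_curve) auto
  have Xv: "partial_v ?X s w = f2 s *\<^sub>R T w" if "w \<in> J" for s w
    unfolding partial_v_def using d\<rho>[OF that]
    by (intro vector_derivative_at) (auto intro!: derivative_eq_intros)
  have Xuu: "partial_u (partial_u ?X) u v = deriv (deriv f1) u *\<^sub>R e + deriv (deriv f2) u *\<^sub>R \<rho> v"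
    unfolding partial_u_def[of "partial_u ?X"]
    by (rule vector_derivative_at,
        rule has_vector_derivative_transform_within_open
          [OF vector_derivative_plane_curve[OF f'] I]) (simp add: Xu)
  have Xuv: "partial_v (partial_u ?X) u v = deriv f2 u *\<^sub>R T v"
    unfolding partial_v_def[of "partial_u ?X"] Xu[OF I(2)] using d\<rho>[OF J(2)]
    by (intro vector_derivative_at) (auto intro!: derivative_eq_intros)
  have "((\<lambda>w. f2 u *\<^sub>R T w) has_vector_derivative f2 u *\<^sub>R (\<kappa> v *\<^sub>R N v - \<rho> v)) (at v)"
    using dT by (auto intro!: derivative_eq_intros)
  then have Xvv: "partial_v (partial_v ?X) u v = f2 u *\<^sub>R (\<kappa> v *\<^sub>R N v - \<rho> v)"
    unfolding partial_v_def[of "partial_v ?X"]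
    by (intro vector_derivative_at, rule has_vector_derivative_transform_within_open[OF _ J])
      (simp add: Xv)
  note inner = inner_add_left inner_add_right inner_diff_left inner_diff_right
  have metric: "g11 ?X u v = 1" "g12 ?X u v = 0" "g22 ?X u v = (f2 u)\<^sup>2"
    using unit_speed
    by (simp_all add: g11_def g12_def g22_def Xu[OF I(2)] Xv[OF J(2)] inner power2_eq_square)
  have second1: "L11 ?X ?N1 u v = 0" "L22 ?X ?N1 u v = f2 u * \<kappa> v"
    by (simp_all add: L11_def L22_def Xuu Xvv inner)
  have second2: "L11 ?X ?N2 u v = - kappa_gamma f1 f2 u" "L22 ?X ?N2 u v = f2 u * deriv f1 u"
    by (simp_all add: L11_def L22_def Xuu Xvv inner kappa_gamma_def inner_commute[of "N v"])
  have coeff: "mean_curvature_coeff ?X ?N1 u v = f2 u * \<kappa> v"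
      "mean_curvature_coeff ?X ?N2 u v = f2 u * (- kappa_gamma f1 f2 u * f2 u + deriv f1 u)"
    by (simp_all add: mean_curvature_coeff_def metric second1 second2 power2_eq_square algebra_simps)
  have "W2 ?X u v = (f2 u)\<^sup>2" by (simp add: W2_def metric)
  moreover have "1 / (2 * (f2 u)\<^sup>2) * (f2 u * x) = 1 / (2 * f2 u) * x" for x
    using f2_nz by (simp add: power2_eq_square)
  ultimately show ?thesis
    unfolding mean_curvature_vector_def coeff
    by (simp only: scaleR_add_right scaleR_scaleR)
qed

lemma profile2_has_derivative:
  "(profile2 c lam has_real_derivative - (lam / c * sin (u / c))) (at u)"
  unfolding profile2_def[abs_def] by (auto intro!: derivative_eq_intros simp: divide_inverse)

lemma deriv_profile2: "deriv (profile2 c lam) = (\<lambda>u. - (lam / c * sin (u / c)))"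
  by (rule ext) (rule DERIV_imp_deriv[OF profile2_has_derivative])

lemma space_curve_orthogonal_e1: "e1 \<bullet> space_curve g1 g2 g3 v = 0"
  by (simp add: space_curve_def inner_add_right)

lemma orthogonal_e1_of_span:
  assumes "x \<in> span {e2, e3, e4}"
  shows "e1 \<bullet> x = 0"
  using orthogonal_to_span[of x "{e2, e3, e4}" e1, OF assms]
  by (fastforce simp: orthogonal_def)

theorem proposition17:
  fixes c lam :: real
    and I J :: "real set"
    and \<phi> g1 g2 g3 \<kappa>\<^sub>\<rho> :: "real \<Rightarrow> real"
    and \<rho> T N :: "real \<Rightarrow> real ^ 4"
    and X N1 N2 :: patch
  assumes "c \<noteq> 0" and "lam > 0"
    and "open I" and "is_interval I"
    and "\<And>u. u \<in> I \<Longrightarrow> cos (u / c) \<noteq> 0"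
    and "\<And>u. u \<in> I \<Longrightarrow> speed_factor c lam u > 0"
    and "\<And>u. u \<in> I \<Longrightarrow> (\<phi> has_real_derivative sqrt (speed_factor c lam u)) (at u)"
    and "open J" and "is_interval J"
    and "smooth_on J g1" and "smooth_on J g2" and "smooth_on J g3"
    and "\<rho> = space_curve g1 g2 g3"
    and "unit_speed_spherical J \<rho>"
    and "spherical_frenet J \<rho> T N \<kappa>\<^sub>\<rho>"
    and "X = spherical_surface c lam \<phi> \<rho>"
    and "N1 = (\<lambda>u v. N v)"
    and "N2 = normal2 c lam \<phi> \<rho>"
  shows "\<forall>u\<in>I. \<forall>v\<in>J.
    mean_curvature_vector X N1 N2 u v =
      (1 / (2 * profile2 c lam u)) *\<^sub>R
        (\<kappa>\<^sub>\<rho> v *\<^sub>R N1 u v +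
         (- kappa_gamma \<phi> (profile2 c lam) u * profile2 c lam u + deriv \<phi> u) *\<^sub>R N2 u v) \<and>
    \<bar>\<kappa>\<^sub>\<rho> v\<bar> =
      sqrt ((deriv (deriv g1) v)\<^sup>2 + (deriv (deriv g2) v)\<^sup>2 + (deriv (deriv g3) v)\<^sup>2 - 1)"
proof (intro ballI conjI)
  fix u v assume u: "u \<in> I" and v: "v \<in> J"
  let ?f = "profile2 c lam"
  have dphi: "deriv \<phi> s = sqrt (speed_factor c lam s)" if "s \<in> I" for s
    using assms(7)[OF that] by (rule DERIV_imp_deriv)
  have "(speed_factor c lam has_real_derivative
      - (lam\<^sup>2 / c\<^sup>2 * (2 * sin (u / c) * (cos (u / c) / c)))) (at u)"
    unfolding speed_factor_def[abs_def]
    using assms(1) by (auto intro!: derivative_eq_intros simp: power2_eq_square mult_ac)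
  \<comment> \<open>Positivity of the speed factor keeps the square root away from its singularity at zero.\<close>
  note root = DERIV_chain2[OF DERIV_real_sqrt[OF assms(6)[OF u]] this]
  have ddphi: "deriv \<phi> differentiable (at u)"
    using has_field_derivative_transform_within_open[OF root assms(3) u, of "deriv \<phi>"] dphi
    by (auto simp: real_differentiable_def)
  have "(deriv ?f has_real_derivative - (lam / c * (cos (u / c) / c))) (at u)"
    unfolding deriv_profile2 by (auto intro!: derivative_eq_intros simp: divide_inverse)
  then have ddf: "deriv ?f differentiable (at u)"
    by (auto simp: real_differentiable_def)
  have unit_speed: "(deriv \<phi> u)\<^sup>2 + (deriv ?f u)\<^sup>2 = 1"
    using assms(6)[OF u]
    by (simp add: dphi[OF u] deriv_profile2 speed_factor_def power_mult_distrib power_divide)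
  have diff: "\<phi> differentiable (at s)" if "s \<in> I" for s
    using assms(7)[OF that] by (auto simp: real_differentiable_def)
  have difff: "?f differentiable (at s)" for s
    using profile2_has_derivative by (auto simp: real_differentiable_def)
  have f_nz: "?f u \<noteq> 0"
    using assms(2) assms(5)[OF u] by (simp add: profile2_def)
  have e1N: "e1 \<bullet> N v = 0"
    using assms(15) v by (auto simp: spherical_frenet_def intro: orthogonal_e1_of_span)
  have e1\<rho>: "e1 \<bullet> \<rho> w = 0" for w
    by (simp add: assms(13) space_curve_orthogonal_e1)
  have e1: "norm e1 = 1" by (simp add: norm_eq_1)
  have X: "X = (\<lambda>u v. \<phi> u *\<^sub>R e1 + ?f u *\<^sub>R \<rho> v)"
    by (simp add: assms(16) spherical_surface_def[abs_def])
  have N2: "N2 = (\<lambda>u v. deriv ?f u *\<^sub>R e1 - deriv \<phi> u *\<^sub>R \<rho> v)"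
    by (simp add: assms(18) normal2_def[abs_def] deriv_profile2)
  show "mean_curvature_vector X N1 N2 u v =
      (1 / (2 * profile2 c lam u)) *\<^sub>R
        (\<kappa>\<^sub>\<rho> v *\<^sub>R N1 u v +
         (- kappa_gamma \<phi> (profile2 c lam) u * profile2 c lam u + deriv \<phi> u) *\<^sub>R N2 u v)"
    unfolding X N2 assms(17)
    by (rule mean_curvature_vector_unit_speed_profile[OF assms(3) u assms(8) v diff difff ddphi ddf
          unit_speed f_nz e1 e1\<rho> e1N assms(14,15)])
  show "\<bar>\<kappa>\<^sub>\<rho> v\<bar> =
      sqrt ((deriv (deriv g1) v)\<^sup>2 + (deriv (deriv g2) v)\<^sup>2 + (deriv (deriv g3) v)\<^sup>2 - 1)"
    using spherical_frenet_curvature[OF assms(8) v assms(10-12)] assms(13-15) by simp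
qed

end
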